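(* Let $P\colon\mathbb N_0\times\mathbb N_0\to[0,+\infty)$ satisfy $P(x,a)P(x+a,b)\le P(x,a+b)$ for $x,a,b\in\mathbb N_0$, together with $P(a,0)=1$ and $P(0,b)=0$ for all $a,b\in\mathbb N$, and $P(a,b)>0$ whenever $a>0$. Then $$P(a,b)=\inf\left\{\frac{f(a)}{f(a+b)} : f\in\mathcal P(P)\right\},\qquad a,b\in\mathbb N_0,\ a+b>0.$$ Conversely, let $\mathcal P$ be an arbitrary family of functions $f\colon\mathbb N_0\to[0,+\infty)$ which vanish only at $0$. Then every mapping $P\colon\mathbb N_0\times\mathbb N_0\to[0,+\infty)$ defined by $$P(a,b)=\inf\left\{\frac{f(a)}{f(a+b)} : f\in\mathcal P\right\},\qquad a,b\in\mathbb N_0,\ a+b>0,$$ with $P(0,0)$ arbitrary, satisfies $P(x,a)P(x+a,b)\le P(x,a+b)$ for $x,a,b\in\mathbb N_0$, satisfies $P(a,0)=1$ and $P(0,b)=0$ for all $a,b\in\mathbb N$, and satisfies $P(a,b)>0$ whenever $a>0$.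
   Context: $\mathbb N$ is the set of positive integers and $\mathbb N_0=\mathbb N\cup\{0\}$. For a map $P\colon\mathbb N_0\times\mathbb N_0\to[0,+\infty)$, $$\mathcal P(P)=\left\{f\colon\mathbb N_0\to[0,+\infty) : f(0)=0,\ f(a)>0 \text{ for } a>0,\ \frac{f(a)}{f(a+b)}\ge P(a,b)\text{ for all } a,b\in\mathbb N\right\}.$$ The value $P(0,0)$ is regarded as undefined/irrelevant: instances of the inequality $P(x,a)P(x+a,b)\le P(x,a+b)$ in which the term $P(0,0)$ occurs are disregarded.
   Formalization: In the converse, P(a,b)>0 for a>0 is claimed only where the ratios f(a)/f(a+b), f in the family, have a common positive lower bound; as printed it fails: f_n(0)=0, f_n(2)=n+1, f_n(k)=1 otherwise gives P(1,1)=0. *)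

theory Defs
  imports "HOL-Library.Extended_Real"
begin

definition vanishes_only_at_0 :: "(nat \<Rightarrow> real) \<Rightarrow> bool" where
  "vanishes_only_at_0 f \<longleftrightarrow> (\<forall>n. 0 \<le> f n) \<and> f 0 = 0 \<and> (\<forall>a>0. 0 < f a)"

definition majorants :: "(nat \<Rightarrow> nat \<Rightarrow> real) \<Rightarrow> (nat \<Rightarrow> real) set" where
  "majorants P = {f. vanishes_only_at_0 f \<and>
     (\<forall>a b. 0 < a \<longrightarrow> 0 < b \<longrightarrow> P a b \<le> f a / f (a + b))}"

text \<open>
  The guard excludes exactly the instances in which the value at \<open>(0, 0)\<close> occurs:
  each of \<open>(x, a)\<close>, \<open>(x + a, b)\<close>, \<open>(x, a + b)\<close> can equal \<open>(0, 0)\<close> only if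
  \<open>x = a = 0\<close>.
\<close>
definition chain_ineq :: "(nat \<Rightarrow> nat \<Rightarrow> real) \<Rightarrow> bool" where
  "chain_ineq P \<longleftrightarrow>
     (\<forall>x a b. (x, a) \<noteq> (0, 0) \<longrightarrow> P x a * P (x + a) b \<le> P x (a + b))"

definition boundary_values :: "(nat \<Rightarrow> nat \<Rightarrow> real) \<Rightarrow> bool" where
  "boundary_values P \<longleftrightarrow> (\<forall>a>0. P a 0 = 1) \<and> (\<forall>b>0. P 0 b = 0)"

text \<open>
  The infimum is taken in the extended reals, where the infimum of the empty set is \<open>\<infinity>\<close>.
  Hence a real-valued \<open>P\<close> is never an infimum over the empty family.
\<close>
definition is_inf_of_ratios :: "(nat \<Rightarrow> nat \<Rightarrow> real) \<Rightarrow> (nat \<Rightarrow> real) set \<Rightarrow> bool" where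
  "is_inf_of_ratios P F \<longleftrightarrow>
     (\<forall>a b. 0 < a + b \<longrightarrow> ereal (P a b) = (INF f\<in>F. ereal (f a / f (a + b))))"

text \<open>
  For an infinite family the infimum can vanish at points with \<open>a > 0\<close>. Positivity of
  an infimum of ratios therefore needs a lower bound that is uniform over the family.
\<close>
lemma inf_of_ratios_may_vanish:
  "\<exists>F P. (\<forall>f\<in>F. vanishes_only_at_0 f) \<and> (\<forall>a b. 0 \<le> P a b) \<and>
     is_inf_of_ratios P F \<and> P 1 1 = 0"
proof -
  define g :: "nat \<Rightarrow> nat \<Rightarrow> real" where
    "g n k = (if k = 0 then 0 else if k = 2 then real (Suc n) else 1)" for n k
  define I where "I a b = (INF f\<in>range g. ereal (f a / f (a + b)))" for a b
  define P where "P a b = real_of_ereal (I a b)" for a b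
  have g: "vanishes_only_at_0 (g n)" for n
    by (auto simp: vanishes_only_at_0_def g_def)
  have nonneg: "0 \<le> I a b" for a b
    unfolding I_def by (rule INF_greatest) (auto simp: g_def)
  have upper: "I a b \<le> ereal (g n a / g n (a + b))" for n a b
    unfolding I_def by (rule INF_lower) simp
  have fin: "\<bar>I a b\<bar> \<noteq> \<infinity>" for a b
    using nonneg[of a b] upper[of a b 0] by (cases "I a b") auto
  have eq: "ereal (P a b) = I a b" for a b
    unfolding P_def using fin by (simp add: ereal_real)
  have P11: "P 1 1 \<le> inverse (real (Suc n))" for n
    using upper[of 1 1 n] unfolding eq[symmetric]
    by (simp add: g_def inverse_eq_divide)
  have "P 1 1 \<le> 0"
  proof (rule ccontr)
    assume "\<not> P 1 1 \<le> 0"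
    then obtain n where "inverse (real (Suc n)) < P 1 1"
      using reals_Archimedean[of "P 1 1"] by auto
    with P11[of n] show False by simp
  qed
  moreover have Pnn: "0 \<le> P a b" for a b
    unfolding P_def using nonneg by (simp add: real_of_ereal_pos)
  ultimately have "P 1 1 = 0" using Pnn[of 1 1] by linarith
  moreover have "is_inf_of_ratios P (range g)"
    unfolding is_inf_of_ratios_def eq I_def by simp
  ultimately show ?thesis using g Pnn by blast
qed

end

theory Submission imports Defs begin

text \<open>
  For the first half the infimum is attained. Given \<open>N > 0\<close>, the chain inequality says exactly
  that \<open>f n = P n (N - n)\<close> satisfies the defining inequality of \<open>majorants P\<close> on \<open>{1..N}\<close>, and
  \<open>f N = 1\<close>, so that \<open>f a / f N = P a (N - a)\<close>. Beyond \<open>N\<close> this \<open>f\<close> is extended by the largest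
  values compatible with the constraints coming from \<open>{1..N}\<close>; the chain inequality again shows
  that the remaining constraints hold. For the second half, multiply
  \<open>f x / f (x + a)\<close> and \<open>f (x + a) / f (x + a + b)\<close> and take infima.
\<close>

text \<open>For \<open>n > N\<close> each entry of the minimum is the constraint
  \<open>P x (n - x) \<le> f x / f n\<close> solved for \<open>f n\<close>, with
  \<open>f x = P x (N - x)\<close>.\<close>

definition extremal :: "(nat \<Rightarrow> nat \<Rightarrow> real) \<Rightarrow> nat \<Rightarrow> nat \<Rightarrow> real" where
  "extremal P N n =
     (if n = 0 then 0
      else if n \<le> N then P n (N - n)
      else Min ((\<lambda>x. P x (N - x) / P x (n - x)) ` {1..N}))"

text \<open>In terms of endpoints and where \<open>P\<close> is positive, this is the triangle
  inequality for the directed distance \<open>- ln (P x (y - x))\<close> from \<open>x\<close> to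
  \<open>y\<close>.\<close>

lemma chain_ineqD:
  assumes "chain_ineq P" "0 < x" "x \<le> y" "y \<le> z"
  shows "P x (y - x) * P y (z - y) \<le> P x (z - x)"
proof -
  have "(x, y - x) \<noteq> (0, 0)"
    using assms(2) by simp
  then have "P x (y - x) * P (x + (y - x)) (z - y) \<le> P x ((y - x) + (z - y))"
    by (rule assms(1)[unfolded chain_ineq_def, rule_format])
  moreover have "x + (y - x) = y" "(y - x) + (z - y) = z - x"
    using assms(3,4) by linarith+
  ultimately show ?thesis
    by (simp only:)
qed

lemma extremal_in_majorants:
  assumes chain: "chain_ineq P" and pos: "\<And>a b. 0 < a \<Longrightarrow> 0 < P a b" and N: "0 < N"
  shows "extremal P N \<in> majorants P"
proof -
  let ?f = "extremal P N"
  have f_pos: "0 < ?f n" if "0 < n" for n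
    using that N by (auto simp: extremal_def pos)
  have f_le: "?f n \<le> P x (N - x) / P x (n - x)" if "N < n" "0 < x" "x \<le> N" for n x
    using that by (auto simp: extremal_def intro!: Min_le)
  have f_attained: "\<exists>x. 0 < x \<and> x \<le> N \<and> ?f n = P x (N - x) / P x (n - x)" if "N < n" for n
  proof -
    have "Min ((\<lambda>x. P x (N - x) / P x (n - x)) ` {1..N})
        \<in> (\<lambda>x. P x (N - x) / P x (n - x)) ` {1..N}"
      using N by (intro Min_in) auto
    then obtain x where "x \<in> {1..N}"
      "Min ((\<lambda>x. P x (N - x) / P x (n - x)) ` {1..N}) = P x (N - x) / P x (n - x)"
      by (elim imageE)
    then show ?thesis
      using that by (intro exI[of _ x]) (simp add: extremal_def)
  qed
  \<comment> \<open>The constraint between \<open>a\<close> and \<open>c\<close>, cleared of its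
    denominator; the cases are the positions of \<open>N\<close> relative to them.\<close>
  have key: "P a (c - a) * ?f c \<le> ?f a" if "0 < a" "a < c" for a c
  proof -
    consider "c \<le> N" | "a \<le> N" "N < c" | "N < a"
      by linarith
    then show ?thesis
    proof cases
      case 1
      then show ?thesis
        using chain_ineqD[OF chain, of a c N] that by (simp add: extremal_def)
    next
      \<comment> \<open>Here the constraint is the entry \<open>x = a\<close> of the minimum that
        defines \<open>?f c\<close>.\<close>
      case 2
      then show ?thesis
        using f_le[of c a] that pos[of a "c - a"]
        by (simp add: extremal_def pos_le_divide_eq mult.commute)
    next
      case 3
      \<comment> \<open>The minimiser is taken for \<open>a\<close>: \<open>?f c\<close> needs only
        an upper bound, and every entry of its minimum supplies one.\<close>
      then obtain x where x: "0 < x" "x \<le> N" and fa: "?f a = P x (N - x) / P x (a - x)"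
        using f_attained by blast
      have "P a (c - a) * ?f c \<le> P a (c - a) * (P x (N - x) / P x (c - x))"
        using f_le[of c x] 3 that x pos[of a] by (intro mult_left_mono) (auto simp: less_imp_le)
      also have "\<dots> \<le> P x (N - x) / P x (a - x)"
      proof -
        have "P x (a - x) * P a (c - a) \<le> P x (c - x)"
          using chain_ineqD[OF chain, of x a c] 3 that x by simp
        then have "P x (N - x) * (P x (a - x) * P a (c - a)) \<le> P x (N - x) * P x (c - x)"
          using pos[of x] x by (intro mult_left_mono) (auto simp: less_imp_le)
        then show ?thesis
          using pos[of x "a - x"] pos[of x "c - x"] x by (simp add: field_simps)
      qed
      finally show ?thesis
        using fa by simp
    qed
  qed
  have "vanishes_only_at_0 ?f"
    unfolding vanishes_only_at_0_def
  proof (intro conjI allI impI)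
    show "0 \<le> ?f n" for n
      using f_pos[of n] by (cases "n = 0") (auto simp: extremal_def)
  qed (auto simp: f_pos extremal_def[of P N 0])
  moreover have "P a b \<le> ?f a / ?f (a + b)" if "0 < a" "0 < b" for a b
    using key[of a "a + b"] f_pos[of "a + b"] that by (simp add: pos_le_divide_eq)
  ultimately show ?thesis
    unfolding majorants_def by blast
qed

lemma vanishes_only_at_0_pos:
  assumes "vanishes_only_at_0 f" "0 < a"
  shows "0 < f a"
  using assms by (simp add: vanishes_only_at_0_def)

text \<open>\<open>majorants\<close> constrains only positive arguments; on the boundary both sides
  agree, being 0 for \<open>a = 0\<close> and 1 for \<open>b = 0\<close>.\<close>

lemma majorants_le_ratio:
  assumes "f \<in> majorants P" "boundary_values P" "0 < a + b"
  shows "P a b \<le> f a / f (a + b)"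
proof -
  have f: "vanishes_only_at_0 f"
    and le: "0 < a \<Longrightarrow> 0 < b \<Longrightarrow> P a b \<le> f a / f (a + b)"
    using assms(1) unfolding majorants_def by blast+
  consider "a = 0" "0 < b" | "0 < a" "b = 0" | "0 < a" "0 < b"
    using assms(3) by linarith
  then show ?thesis
  proof cases
    case 1
    then show ?thesis
      using f assms(2) by (simp add: vanishes_only_at_0_def boundary_values_def)
  next
    case 2
    then show ?thesis
      using vanishes_only_at_0_pos[OF f, of a] assms(2) by (simp add: boundary_values_def)
  qed (rule le)
qed

text \<open>The choice \<open>N = a + b\<close> normalises the denominator to
  \<open>P (a + b) 0 = 1\<close>, and a positive \<open>a\<close> falls in the branch
  \<open>n \<le> N\<close>, whose value is \<open>P a b\<close>.\<close>

lemma extremal_ratio: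
  assumes "boundary_values P" "0 < a + b"
  shows "extremal P (a + b) a / extremal P (a + b) (a + b) = P a b"
proof (cases "a = 0")
  case True
  then show ?thesis
    using assms by (simp add: boundary_values_def extremal_def)
next
  case False
  then have "P (a + b) 0 = 1"
    using assms by (simp add: boundary_values_def)
  then show ?thesis
    using False by (simp add: extremal_def)
qed

lemma is_inf_of_ratios_majorants:
  assumes "chain_ineq P" "boundary_values P" "\<And>a b. 0 < a \<Longrightarrow> 0 < P a b"
  shows "is_inf_of_ratios P (majorants P)"
  unfolding is_inf_of_ratios_def
proof (intro allI impI antisym)
  fix a b :: nat
  assume ab: "0 < a + b"
  show "ereal (P a b) \<le> (INF f\<in>majorants P. ereal (f a / f (a + b)))"
    using majorants_le_ratio[OF _ assms(2) ab] by (intro INF_greatest) simp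
  \<comment> \<open>One member with ratio \<open>P a b\<close> suffices, and it may vary with the
    pair.\<close>
  have "extremal P (a + b) \<in> majorants P"
    using extremal_in_majorants[OF assms(1,3) ab] .
  then show "(INF f\<in>majorants P. ereal (f a / f (a + b))) \<le> ereal (P a b)"
    by (rule INF_lower2) (simp add: extremal_ratio[OF assms(2) ab])
qed

lemma is_inf_of_ratiosD:
  assumes "is_inf_of_ratios P F" "0 < a + b"
  shows "ereal (P a b) = (INF f\<in>F. ereal (f a / f (a + b)))"
  using assms by (simp only: is_inf_of_ratios_def)

lemma is_inf_of_ratios_lower:
  assumes "is_inf_of_ratios P F" "f \<in> F" "0 < a + b"
  shows "P a b \<le> f a / f (a + b)"
proof -
  have "ereal (P a b) = (INF f\<in>F. ereal (f a / f (a + b)))"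
    using assms(1,3) by (rule is_inf_of_ratiosD)
  also have "\<dots> \<le> ereal (f a / f (a + b))"
    using assms(2) by (rule INF_lower)
  finally have "ereal (P a b) \<le> ereal (f a / f (a + b))" .
  then show ?thesis
    by simp
qed

lemma is_inf_of_ratios_greatest:
  assumes "is_inf_of_ratios P F" "0 < a + b" "\<And>f. f \<in> F \<Longrightarrow> c \<le> f a / f (a + b)"
  shows "c \<le> P a b"
proof -
  have "ereal c \<le> (INF f\<in>F. ereal (f a / f (a + b)))"
    using assms(3) by (intro INF_greatest) simp
  also have "\<dots> = ereal (P a b)"
    using is_inf_of_ratiosD[OF assms(1,2)] by (rule sym)
  finally have "ereal c \<le> ereal (P a b)" .
  then show ?thesis
    by simp
qed

text \<open>Supplies the member of \<open>F\<close> from which upper bounds on \<open>P\<close> are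
  read off.\<close>

lemma is_inf_of_ratios_nonempty:
  assumes "is_inf_of_ratios P F"
  shows "F \<noteq> {}"
proof
  assume "F = {}"
  moreover have "ereal (P 1 0) = (INF f\<in>F. ereal (f 1 / f (1 + 0)))"
    using assms by (rule is_inf_of_ratiosD) simp
  ultimately show False
    by (simp add: top_ereal_def)
qed

text \<open>On each boundary the ratio is the same for all members of \<open>F\<close>, and the
  infimum of a constant over a nonempty family is that constant.\<close>

lemma boundary_values_inf_of_ratios:
  assumes inf: "is_inf_of_ratios P F" and F: "\<And>f. f \<in> F \<Longrightarrow> vanishes_only_at_0 f"
  shows "boundary_values P"
proof -
  obtain f where f: "f \<in> F"
    using is_inf_of_ratios_nonempty[OF inf] by blast
  have ratio_1: "g a / g (a + 0) = 1" if "g \<in> F" "0 < a" for g a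
    using vanishes_only_at_0_pos[OF F[OF that(1)] that(2)] by simp
  have at_0: "g 0 = 0" if "g \<in> F" for g
    using F[OF that] by (simp add: vanishes_only_at_0_def)
  show ?thesis
    unfolding boundary_values_def
  proof (intro conjI allI impI antisym)
    fix a :: nat
    assume a: "0 < a"
    show "P a 0 \<le> 1"
      using is_inf_of_ratios_lower[OF inf f, of a 0] ratio_1[OF f a] a by simp
    show "1 \<le> P a 0"
      by (rule is_inf_of_ratios_greatest[OF inf]) (use ratio_1 a in auto)
    show "P 0 a \<le> 0"
      using is_inf_of_ratios_lower[OF inf f, of 0 a] at_0[OF f] a by simp
    show "0 \<le> P 0 a"
      by (rule is_inf_of_ratios_greatest[OF inf]) (use a in \<open>simp_all add: at_0\<close>)
  qed
qed

lemma chain_ineq_inf_of_ratios: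
  assumes inf: "is_inf_of_ratios P F" and F: "\<And>f. f \<in> F \<Longrightarrow> vanishes_only_at_0 f"
    and nonneg: "\<And>a b. 0 \<le> P a b"
  shows "chain_ineq P"
  unfolding chain_ineq_def
proof (intro allI impI)
  fix x a b :: nat
  assume xa: "(x, a) \<noteq> (0, 0)"
  show "P x a * P (x + a) b \<le> P x (a + b)"
  proof (cases "x = 0")
    case True
    \<comment> \<open>The guard gives \<open>a > 0\<close>, so the left side contains the factor
      \<open>P 0 a = 0\<close>.\<close>
    then show ?thesis
      using boundary_values_inf_of_ratios[OF inf F] xa nonneg[of 0 "a + b"]
      by (simp add: boundary_values_def)
  next
    case False
    show ?thesis
    proof (rule is_inf_of_ratios_greatest[OF inf])
      fix f
      assume f: "f \<in> F"
      note pos = vanishes_only_at_0_pos[OF F[OF f]]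
      \<comment> \<open>The same \<open>f\<close> bounds both factors, so \<open>f (x + a)\<close>
        cancels; nonnegativity allows the two bounds to be multiplied.\<close>
      have "P x a * P (x + a) b \<le> f x / f (x + a) * (f (x + a) / f (x + a + b))"
        using False pos[of x] pos[of "x + a"]
        by (intro mult_mono is_inf_of_ratios_lower[OF inf f] nonneg) auto
      also have "\<dots> = f x / f (x + (a + b))"
        using pos[of "x + a"] False by (simp add: add.assoc)
      finally show "P x a * P (x + a) b \<le> f x / f (x + (a + b))" .
    qed (use False in simp)
  qed
qed

text \<open>In the converse, positivity is claimed only where the ratios have a positive lower bound
  uniform over \<open>F\<close>; \<open>inf_of_ratios_may_vanish\<close> shows that it can fail
  otherwise.\<close>

theorem corollary4:
  "(\<forall>P :: nat \<Rightarrow> nat \<Rightarrow> real.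
      (\<forall>a b. 0 \<le> P a b) \<longrightarrow> chain_ineq P \<longrightarrow> boundary_values P \<longrightarrow>
      (\<forall>a b. 0 < a \<longrightarrow> 0 < P a b) \<longrightarrow>
      is_inf_of_ratios P (majorants P))
   \<and>
   (\<forall>(F :: (nat \<Rightarrow> real) set) (P :: nat \<Rightarrow> nat \<Rightarrow> real).
      (\<forall>f\<in>F. vanishes_only_at_0 f) \<longrightarrow> (\<forall>a b. 0 \<le> P a b) \<longrightarrow> is_inf_of_ratios P F \<longrightarrow>
      chain_ineq P \<and> boundary_values P \<and>
      (\<forall>a b. 0 < a \<longrightarrow> (\<exists>c>0. \<forall>f\<in>F. c \<le> f a / f (a + b)) \<longrightarrow> 0 < P a b))"
proof (intro conjI allI impI)
  fix P :: "nat \<Rightarrow> nat \<Rightarrow> real"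
  assume "chain_ineq P" "boundary_values P" "\<forall>a b. 0 < a \<longrightarrow> 0 < P a b"
  then show "is_inf_of_ratios P (majorants P)"
    by (intro is_inf_of_ratios_majorants) auto
next
  fix F :: "(nat \<Rightarrow> real) set" and P :: "nat \<Rightarrow> nat \<Rightarrow> real"
  assume F: "\<forall>f\<in>F. vanishes_only_at_0 f" and nonneg: "\<forall>a b. 0 \<le> P a b"
    and inf: "is_inf_of_ratios P F"
  show "chain_ineq P"
    using chain_ineq_inf_of_ratios[OF inf] F nonneg by blast
  show "boundary_values P"
    using boundary_values_inf_of_ratios[OF inf] F by blast
  fix a b :: nat
  assume a: "0 < a" and "\<exists>c>0. \<forall>f\<in>F. c \<le> f a / f (a + b)"
  then obtain c where "0 < c" and c: "\<And>f. f \<in> F \<Longrightarrow> c \<le> f a / f (a + b)"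
    by blast
  have "c \<le> P a b"
    by (rule is_inf_of_ratios_greatest[OF inf]) (use a c in auto)
  with \<open>0 < c\<close> show "0 < P a b"
    by simp
qed

end
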